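(* Let $X=\{X_Q\}_Q$ be a family of normalized quasi-Banach function spaces, indexed by the cubes $Q\subset\mathbb{R}^n$. The following statements are equivalent: (i) $\mathrm{BMO}_X\hookrightarrow\mathrm{BMO}$, i.e. there is a constant $C>0$ such that $\|f\|_{\mathrm{BMO}}\le C\|f\|_{\mathrm{BMO}_X}$ for all $f\in\mathrm{BMO}_X$. (ii) There is a constant $C>0$ such that for all $f\in\mathrm{BMO}_X$ we have $\big\||f|\big\|_{\mathrm{BMO}_X}\le C\|f\|_{\mathrm{BMO}_X}$.
   Context: Cubes $Q\subset\mathbb{R}^n$ have sides parallel to the axes, and $\langle f\rangle_Q:=\frac1{|Q|}\int_Q f$. A quasi-Banach function space over a cube $Q$ is an order ideal $X_Q$ of the space of measurable functions $Q\to\mathbb{R}$, equipped with a quasi-norm $\|\cdot\|_{X_Q}$, such that: (Compatibility) if $f,g\in X_Q$ and $|f|\le|g|$ then $\|f\|_{X_Q}\le\|g\|_{X_Q}$; (Weak order unit) there is $f\in X_Q$ with $f>0$ a.e.; (Fatou property) if $0\le f_m\uparrow f$ with $f_m \in X_Q$ and $\sup_m\|f_m\|_{X_Q}<\infty$, then $f\in X_Q$ and $\|f\|_{X_Q}=\sup_m\|f_m\|_{X_Q}$. We put $\|f\|_{X_Q}=\infty$ if $f\notin X_Q$; for $f$ defined on $\mathbb{R}^n$, $\|f\|_{X_Q}$ means the quasi-norm of the restriction of $f$ to $Q$. $X=\{X_Q\}$ is a family of normalized quasi-Banach function spaces if for every cube $Q$, $X_Q$ is a quasi-Banach function space over $Q$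 and $\|\chi_Q\|_{X_Q}\simeq1$, with implicit constants independent of $Q$. $\mathrm{BMO}$ is the space of locally integrable $f:\mathbb{R}^n\to\mathbb{R}$ with $\|f\|_{\mathrm{BMO}}:=\sup_Q\frac1{|Q|}\int_Q|f-\langle f\rangle_Q|<\infty$. $\mathrm{BMO}_X$ is the space of locally integrable $f:\mathbb{R}^n\to\mathbb{R}$ with $\|f\|_{\mathrm{BMO}_X}:=\sup_Q\|f-\langle f\rangle_Q\|_{X_Q}<\infty$.
   Formalization: The formal theorem additionally assumes that the constant in the quasi-triangle inequality of the spaces X_Q can be chosen independently of the cube Q; without this uniformity the equivalence is false, since (i) can hold while (ii) fails. *)

theory Defs
  imports "HOL-Analysis.Analysis"
begin

text \<open>Cubes are closed and nondegenerate; every integral and almost-everywhere statement below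
  is insensitive to the boundary.\<close>

definition cubes :: "(real ^ 'n) set set" where
  "cubes = {cbox a (\<chi> i. a $ i + l) | a l. 0 < l}"

definition avg :: "(real ^ 'n) set \<Rightarrow> (real ^ 'n \<Rightarrow> real) \<Rightarrow> real" where
  "avg Q f = (1 / measure lebesgue Q) * (LINT x:Q|lebesgue. f x)"

definition locally_integrable :: "(real ^ 'n \<Rightarrow> real) \<Rightarrow> bool" where
  "locally_integrable f \<longleftrightarrow> (\<forall>K. compact K \<longrightarrow> set_integrable lebesgue K f)"

text \<open>A function on \<open>Q\<close> is represented by a function on the whole space whose values off \<open>Q\<close>
  are irrelevant. All pointwise relations are required only almost everywhere on \<open>Q\<close>; in
  particular the order ideal property and compatibility make membership in \<open>S\<close> and the value of
  \<open>N\<close> on \<open>S\<close> depend only on the class of the function modulo equality a.e. on \<open>Q\<close>.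
  So restricting a function to \<open>Q\<close> is implicit, and \<open>N\<close> matters on \<open>S\<close> only.\<close>

definition order_ideal_on ::
    "(real ^ 'n) set \<Rightarrow> (real ^ 'n \<Rightarrow> real) set \<Rightarrow> bool" where
  "order_ideal_on Q S \<longleftrightarrow>
     S \<subseteq> borel_measurable (lebesgue_on Q) \<and>
     (\<lambda>x. 0) \<in> S \<and>
     (\<forall>f\<in>S. \<forall>g\<in>S. (\<lambda>x. f x + g x) \<in> S) \<and>
     (\<forall>c. \<forall>f\<in>S. (\<lambda>x. c * f x) \<in> S) \<and>
     (\<forall>f\<in>S. \<forall>g\<in>borel_measurable (lebesgue_on Q).
        (AE x in lebesgue_on Q. \<bar>g x\<bar> \<le> \<bar>f x\<bar>) \<longrightarrow> g \<in> S)"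

definition quasi_triangle ::
    "real \<Rightarrow> (real ^ 'n \<Rightarrow> real) set \<Rightarrow> ((real ^ 'n \<Rightarrow> real) \<Rightarrow> real) \<Rightarrow> bool" where
  "quasi_triangle K S N \<longleftrightarrow>
     (\<forall>f\<in>S. \<forall>g\<in>S. N (\<lambda>x. f x + g x) \<le> K * (N f + N g))"

definition quasi_norm_on ::
    "(real ^ 'n) set \<Rightarrow> (real ^ 'n \<Rightarrow> real) set \<Rightarrow> ((real ^ 'n \<Rightarrow> real) \<Rightarrow> real) \<Rightarrow> bool" where
  "quasi_norm_on Q S N \<longleftrightarrow>
     (\<forall>f\<in>S. 0 \<le> N f) \<and>
     (\<forall>f\<in>S. N f = 0 \<longleftrightarrow> (AE x in lebesgue_on Q. f x = 0)) \<and>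
     (\<forall>c. \<forall>f\<in>S. N (\<lambda>x. c * f x) = \<bar>c\<bar> * N f) \<and>
     (\<exists>K. quasi_triangle K S N)"

text \<open>Completeness is not listed: it is a consequence of the Fatou property.\<close>

definition quasi_banach_function_space ::
    "(real ^ 'n) set \<Rightarrow> (real ^ 'n \<Rightarrow> real) set \<Rightarrow> ((real ^ 'n \<Rightarrow> real) \<Rightarrow> real) \<Rightarrow> bool" where
  "quasi_banach_function_space Q S N \<longleftrightarrow>
     order_ideal_on Q S \<and>
     quasi_norm_on Q S N \<and>
     (\<forall>f\<in>S. \<forall>g\<in>S. (AE x in lebesgue_on Q. \<bar>f x\<bar> \<le> \<bar>g x\<bar>) \<longrightarrow> N f \<le> N g) \<and>
     (\<exists>f\<in>S. AE x in lebesgue_on Q. 0 < f x) \<and>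
     (\<forall>F. \<forall>f\<in>borel_measurable (lebesgue_on Q).
        (\<forall>m. F m \<in> S) \<and>
        (AE x in lebesgue_on Q.
           (\<forall>m. 0 \<le> F m x) \<and> incseq (\<lambda>m. F m x) \<and> (\<lambda>m. F m x) \<longlonglongrightarrow> f x) \<and>
        bdd_above (range (\<lambda>m. N (F m)))
        \<longrightarrow> f \<in> S \<and> N f = (SUP m. N (F m)))"

definition ext_norm ::
    "(real ^ 'n \<Rightarrow> real) set \<Rightarrow> ((real ^ 'n \<Rightarrow> real) \<Rightarrow> real) \<Rightarrow> (real ^ 'n \<Rightarrow> real) \<Rightarrow> ennreal" where
  "ext_norm S N f = (if f \<in> S then ennreal (N f) else \<infinity>)"

definition normalized_family ::
    "((real ^ 'n) set \<Rightarrow> (real ^ 'n \<Rightarrow> real) set) \<Rightarrow>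
     ((real ^ 'n) set \<Rightarrow> (real ^ 'n \<Rightarrow> real) \<Rightarrow> real) \<Rightarrow> bool" where
  "normalized_family X N \<longleftrightarrow>
     (\<forall>Q\<in>cubes. quasi_banach_function_space Q (X Q) (N Q)) \<and>
     (\<exists>c>0. \<exists>C>0. \<forall>Q\<in>cubes.
        ennreal c \<le> ext_norm (X Q) (N Q) (indicat_real Q) \<and>
        ext_norm (X Q) (N Q) (indicat_real Q) \<le> ennreal C)"

text \<open>The constant in the quasi-triangle inequality can be chosen independently of the cube.
  For a family of Banach function spaces this holds with constant \<open>1\<close>. For quasi-norms it does not
  follow from the existence of a constant on each cube, and the equivalence of \<open>BMO_X \<hookrightarrow> BMO\<close> with
  boundedness of \<open>f \<mapsto> \<bar>f\<bar>\<close> on \<open>BMO_X\<close> fails without it: on a sequence of disjoint cubes \<open>Q\<close> take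
  \<open>N f = avg Q \<bar>f\<bar> + sqrt (avg A \<bar>f\<bar> * avg B \<bar>f\<bar>)\<close> with disjoint cubes \<open>A, B \<subseteq> Q\<close> of which
  \<open>A\<close> shrinks relative to \<open>Q\<close>, and \<open>N f = avg Q \<bar>f\<bar>\<close> on all other cubes. The first property holds
  since \<open>N f \<ge> avg Q \<bar>f\<bar>\<close>; the second one fails for \<open>f\<close> with support in \<open>Q\<close>, \<open>avg Q f = 0\<close>, \<open>f = 0\<close>
  on \<open>B\<close>, with a truncated logarithmic singularity in \<open>A\<close>.\<close>

definition uniform_quasi_triangle ::
    "((real ^ 'n) set \<Rightarrow> (real ^ 'n \<Rightarrow> real) set) \<Rightarrow>
     ((real ^ 'n) set \<Rightarrow> (real ^ 'n \<Rightarrow> real) \<Rightarrow> real) \<Rightarrow> bool" where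
  "uniform_quasi_triangle X N \<longleftrightarrow> (\<exists>K. \<forall>Q\<in>cubes. quasi_triangle K (X Q) (N Q))"

definition bmo_norm :: "(real ^ 'n \<Rightarrow> real) \<Rightarrow> ennreal" where
  "bmo_norm f = (SUP Q\<in>cubes. ennreal (avg Q (\<lambda>x. \<bar>f x - avg Q f\<bar>)))"

definition BMO :: "(real ^ 'n \<Rightarrow> real) set" where
  "BMO = {f. locally_integrable f \<and> bmo_norm f < \<infinity>}"

definition bmo_X_norm ::
    "((real ^ 'n) set \<Rightarrow> (real ^ 'n \<Rightarrow> real) set) \<Rightarrow>
     ((real ^ 'n) set \<Rightarrow> (real ^ 'n \<Rightarrow> real) \<Rightarrow> real) \<Rightarrow> (real ^ 'n \<Rightarrow> real) \<Rightarrow> ennreal" where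
  "bmo_X_norm X N f = (SUP Q\<in>cubes. ext_norm (X Q) (N Q) (\<lambda>x. f x - avg Q f))"

definition BMO_X ::
    "((real ^ 'n) set \<Rightarrow> (real ^ 'n \<Rightarrow> real) set) \<Rightarrow>
     ((real ^ 'n) set \<Rightarrow> (real ^ 'n \<Rightarrow> real) \<Rightarrow> real) \<Rightarrow> (real ^ 'n \<Rightarrow> real) set" where
  "BMO_X X N = {f. locally_integrable f \<and> bmo_X_norm X N f < \<infinity>}"

end

theory Submission
  imports Defs
begin

text \<open>Both directions rest on a pointwise comparison on a cube \<open>Q\<close>, writing \<open>a = avg Q f\<close> and
  \<open>m = avg Q \<bar>f - a\<bar>\<close>. On the one hand \<open>\<bar>\<bar>f\<bar> - avg Q \<bar>f\<bar>\<bar> \<le> \<bar>f - a\<bar> + m\<close>, so a bound on \<open>m\<close>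
  controls the oscillation of \<open>\<bar>f\<bar>\<close>. On the other hand \<open>m \<le> \<bar>\<bar>f - a\<bar> - m\<bar> + \<bar>f - a\<bar>\<close>, where the
  first term is the oscillation on \<open>Q\<close> of the absolute value of \<open>f - a\<close>, a function with the same
  \<open>BMO_X\<close> norm as \<open>f\<close>.\<close>

section \<open>Cubes, averages and the two oscillation norms\<close>

lemma cubes_compact: "Q \<in> cubes \<Longrightarrow> compact Q"
  by (auto simp: cubes_def)

lemma cubes_lmeasurable: "Q \<in> cubes \<Longrightarrow> Q \<in> lmeasurable"
  by (auto simp: cubes_def)

lemma cubes_measure_pos:
  assumes "Q \<in> cubes"
  shows "0 < measure lebesgue Q"
proof -
  obtain a :: "real ^ 'a" and l where Q: "Q = cbox a (\<chi> i. a $ i + l)" and l: "0 < l"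
    using assms by (auto simp: cubes_def)
  have "box a (\<chi> i. a $ i + l) \<noteq> {}"
    using l by (simp add: box_ne_empty Basis_vec_def inner_axis)
  then have "0 < measure lborel Q"
    unfolding Q by (simp add: content_pos_lt_eq box_ne_empty)
  then show ?thesis
    by (simp add: Q measure_completion)
qed

lemma locally_integrable_on_cube:
  "locally_integrable f \<Longrightarrow> Q \<in> cubes \<Longrightarrow> set_integrable lebesgue Q f"
  by (simp add: locally_integrable_def cubes_compact)

lemma locally_integrable_measurable_on_cube:
  assumes "locally_integrable f" "Q \<in> cubes"
  shows "f \<in> borel_measurable (lebesgue_on Q)"
  using locally_integrable_on_cube[OF assms] cubes_lmeasurable[OF assms(2)]
  by (auto simp: set_integrable_def borel_measurable_restrict_space_iff
      dest: borel_measurable_integrable)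

lemma set_integrable_const_lmeasurable:
  "Q \<in> lmeasurable \<Longrightarrow> set_integrable lebesgue Q (\<lambda>x. c :: real)"
  by (auto simp: set_integrable_def fmeasurable_def)

lemma set_integral_const_lmeasurable:
  "Q \<in> lmeasurable \<Longrightarrow> (LINT x:Q|lebesgue. c) = measure lebesgue Q * (c :: real)"
  by (simp add: set_lebesgue_integral_def)

lemma locally_integrable_diff_const:
  "locally_integrable f \<Longrightarrow> locally_integrable (\<lambda>x. f x - c)"
  by (simp add: locally_integrable_def set_integral_diff set_integrable_const_lmeasurable
      lmeasurable_compact)

lemma locally_integrable_abs:
  "locally_integrable f \<Longrightarrow> locally_integrable (\<lambda>x. \<bar>f x\<bar>)"
  by (simp add: locally_integrable_def set_integrable_abs)

lemma avg_diff_const: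
  assumes "Q \<in> cubes" "set_integrable lebesgue Q f"
  shows "avg Q (\<lambda>x. f x - c) = avg Q f - c"
proof -
  have "(LINT x:Q|lebesgue. f x - c) = (LINT x:Q|lebesgue. f x) - measure lebesgue Q * c"
    using assms(2) cubes_lmeasurable[OF assms(1)]
    by (simp add: set_integral_diff(2) set_integrable_const_lmeasurable set_integral_const_lmeasurable)
  then show ?thesis
    using cubes_measure_pos[OF assms(1)] by (simp add: avg_def field_simps)
qed

lemma avg_nonneg: "(\<And>x. 0 \<le> f x) \<Longrightarrow> 0 \<le> avg Q f"
  by (simp add: avg_def set_lebesgue_integral_def)

lemma avg_mono:
  assumes "set_integrable lebesgue Q f" "set_integrable lebesgue Q g" "\<And>x. f x \<le> g x"
  shows "avg Q f \<le> avg Q g"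
  using set_integral_mono[OF assms] by (simp add: avg_def mult_left_mono divide_right_mono)

text \<open>For nonintegrable \<open>f\<close> the left side is 0 by the convention for integrals,
  and the right side is nonnegative.\<close>

lemma abs_avg_le_avg_abs: "\<bar>avg Q f\<bar> \<le> avg Q (\<lambda>x. \<bar>f x\<bar>)"
proof -
  have "\<bar>LINT x:Q|lebesgue. f x\<bar> \<le> (LINT x:Q|lebesgue. \<bar>f x\<bar>)"
    using integral_abs_bound[of lebesgue "\<lambda>x. indicator Q x * f x"]
    by (simp add: set_lebesgue_integral_def abs_mult)
  then show ?thesis
    by (simp add: avg_def abs_mult mult_left_mono divide_right_mono)
qed

text \<open>Average the reverse triangle inequality \<open>\<bar>\<bar>f x\<bar> -
  \<bar>c\<bar>\<bar> \<le> \<bar>f x - c\<bar>\<close>. With \<open>c = avg Q f\<close> this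
  controls the error of replacing \<open>avg Q \<bar>f\<bar>\<close> by
  \<open>\<bar>avg Q f\<bar>\<close>.\<close>

lemma abs_avg_abs_diff_le:
  assumes "locally_integrable f" "Q \<in> cubes"
  shows "\<bar>avg Q (\<lambda>x. \<bar>f x\<bar>) - \<bar>c\<bar>\<bar> \<le> avg Q (\<lambda>x. \<bar>f x - c\<bar>)"
proof -
  note int = locally_integrable_on_cube[OF locally_integrable_abs assms(2)]
  have "\<bar>avg Q (\<lambda>x. \<bar>f x\<bar>) - \<bar>c\<bar>\<bar> = \<bar>avg Q (\<lambda>x. \<bar>f x\<bar> - \<bar>c\<bar>)\<bar>"
    by (simp add: avg_diff_const assms int)
  also have "\<dots> \<le> avg Q (\<lambda>x. \<bar>\<bar>f x\<bar> - \<bar>c\<bar>\<bar>)"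
    by (rule abs_avg_le_avg_abs)
  also have "\<dots> \<le> avg Q (\<lambda>x. \<bar>f x - c\<bar>)"
    by (rule avg_mono) (auto intro!: int locally_integrable_diff_const locally_integrable_abs assms)
  finally show ?thesis .
qed

text \<open>A shift moves every average by the same constant, so each oscillation is unchanged. The
  constant may thus be chosen separately for each cube, as \<open>avg Q f\<close>, at no cost in the
  norm.\<close>

lemma bmo_X_norm_diff_const:
  assumes "locally_integrable f"
  shows "bmo_X_norm X N (\<lambda>x. f x - c) = bmo_X_norm X N f"
  unfolding bmo_X_norm_def
  by (intro SUP_cong refl) (simp add: avg_diff_const locally_integrable_on_cube assms)

text \<open>The value off \<open>S\<close> is infinite, so a finite bound also carries membership.
  Negative \<open>r\<close> is excluded because \<open>ennreal r\<close> would then be 0.\<close>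

lemma ext_norm_le_iff:
  "0 \<le> r \<Longrightarrow> ext_norm S N f \<le> ennreal r \<longleftrightarrow> f \<in> S \<and> N f \<le> r"
  by (simp add: ext_norm_def ennreal_le_iff top_unique)

lemma bmo_X_norm_le_iff:
  "0 \<le> r \<Longrightarrow> bmo_X_norm X N f \<le> ennreal r \<longleftrightarrow>
    (\<forall>Q\<in>cubes. (\<lambda>x. f x - avg Q f) \<in> X Q \<and> N Q (\<lambda>x. f x - avg Q f) \<le> r)"
  by (simp add: bmo_X_norm_def SUP_le_iff ext_norm_le_iff)

lemma bmo_norm_le_iff:
  "0 \<le> r \<Longrightarrow> bmo_norm f \<le> ennreal r \<longleftrightarrow> (\<forall>Q\<in>cubes. avg Q (\<lambda>x. \<bar>f x - avg Q f\<bar>) \<le> r)"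
  by (simp add: bmo_norm_def SUP_le_iff ennreal_le_iff)

lemma BMO_X_D:
  assumes "f \<in> BMO_X X N"
  obtains B where "locally_integrable f" "0 \<le> B" "bmo_X_norm X N f = ennreal B"
  using assms by (cases "bmo_X_norm X N f") (auto simp: BMO_X_def)

section \<open>Quasi-norm estimates on a single cube\<close>

lemma quasi_banach_function_space_measurable:
  "quasi_banach_function_space Q S N \<Longrightarrow> S \<subseteq> borel_measurable (lebesgue_on Q)"
  unfolding quasi_banach_function_space_def order_ideal_on_def by (elim conjE)

text \<open>The common estimate of both directions: \<open>\<bar>f\<bar> + \<bar>g\<bar>\<close>
  lies in the ideal and passes membership and its norm bound down to \<open>h\<close>. Domination is
  asked for on \<open>Q\<close> only, so a constant can be represented by a multiple of
  \<open>indicat_real Q\<close>.\<close>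

lemma quasi_norm_dominated:
  assumes X: "quasi_banach_function_space Q S N" and K: "quasi_triangle K S N"
    and f: "f \<in> S" and g: "g \<in> S" and h: "h \<in> borel_measurable (lebesgue_on Q)"
    and le: "\<And>x. x \<in> Q \<Longrightarrow> \<bar>h x\<bar> \<le> \<bar>f x\<bar> + \<bar>g x\<bar>"
  shows "h \<in> S" "N h \<le> K * (N f + N g)"
proof -
  have S: "S \<subseteq> borel_measurable (lebesgue_on Q)"
    using X by (rule quasi_banach_function_space_measurable)
  have add: "\<forall>f\<in>S. \<forall>g\<in>S. (\<lambda>x. f x + g x) \<in> S"
    and ideal: "\<forall>f\<in>S. \<forall>g\<in>borel_measurable (lebesgue_on Q).
      (AE x in lebesgue_on Q. \<bar>g x\<bar> \<le> \<bar>f x\<bar>) \<longrightarrow> g \<in> S"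
    and mono: "\<forall>f\<in>S. \<forall>g\<in>S. (AE x in lebesgue_on Q. \<bar>f x\<bar> \<le> \<bar>g x\<bar>) \<longrightarrow> N f \<le> N g"
    using X unfolding quasi_banach_function_space_def order_ideal_on_def
    by - (elim conjE; assumption)+
  note add = add[rule_format] and ideal = ideal[rule_format] and mono = mono[rule_format]
  \<comment> \<open>\<open>u\<close> and \<open>\<bar>u\<bar>\<close> dominate each other, so
    monotonicity applies both ways.\<close>
  have abs: "(\<lambda>x. \<bar>u x\<bar>) \<in> S \<and> N (\<lambda>x. \<bar>u x\<bar>) = N u" if "u \<in> S" for u
  proof -
    have "(\<lambda>x. \<bar>u x\<bar>) \<in> S"
      using S that by (intro ideal[OF that]) auto
    then show ?thesis
      using that by (auto intro!: antisym mono)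
  qed
  have sum: "(\<lambda>x. \<bar>f x\<bar> + \<bar>g x\<bar>) \<in> S"
    by (simp add: add abs f g)
  have AE: "AE x in lebesgue_on Q. \<bar>h x\<bar> \<le> \<bar>\<bar>f x\<bar> + \<bar>g x\<bar>\<bar>"
    using le by (auto intro!: AE_I2)
  show hS: "h \<in> S"
    by (rule ideal[OF sum h AE])
  have "N h \<le> N (\<lambda>x. \<bar>f x\<bar> + \<bar>g x\<bar>)"
    by (rule mono[OF hS sum AE])
  also have "\<dots> \<le> K * (N (\<lambda>x. \<bar>f x\<bar>) + N (\<lambda>x. \<bar>g x\<bar>))"
    by (rule K[unfolded quasi_triangle_def, rule_format]) (simp_all add: abs f g)
  finally show "N h \<le> K * (N f + N g)"
    by (simp add: abs f g)
qed

lemma quasi_norm_const_mult: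
  assumes "quasi_banach_function_space Q S N" "f \<in> S" "0 \<le> c"
  shows "(\<lambda>x. c * f x) \<in> S" "N (\<lambda>x. c * f x) = c * N f"
  using assms unfolding quasi_banach_function_space_def order_ideal_on_def quasi_norm_on_def
  by auto

lemma quasi_triangle_mono:
  assumes X: "quasi_banach_function_space Q S N" and "quasi_triangle K S N" "K \<le> K'"
  shows "quasi_triangle K' S N"
  unfolding quasi_triangle_def
proof (intro ballI)
  fix f g assume fg: "f \<in> S" "g \<in> S"
  have "0 \<le> N f + N g"
    using X fg by (simp add: quasi_banach_function_space_def quasi_norm_on_def)
  then have "K * (N f + N g) \<le> K' * (N f + N g)"
    using \<open>K \<le> K'\<close> by (rule mult_right_mono[rotated])
  then show "N (\<lambda>x. f x + g x) \<le> K' * (N f + N g)"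
    using assms(2) fg unfolding quasi_triangle_def by (blast intro: order_trans)
qed

lemma normalized_familyE:
  assumes "normalized_family X N" "uniform_quasi_triangle X N"
  obtains K c C where "0 < K" "0 < c" "0 < C"
    "\<And>Q. Q \<in> cubes \<Longrightarrow> quasi_banach_function_space Q (X Q) (N Q)"
    "\<And>Q. Q \<in> cubes \<Longrightarrow> quasi_triangle K (X Q) (N Q)"
    "\<And>Q. Q \<in> cubes \<Longrightarrow> indicat_real Q \<in> X Q"
    "\<And>Q. Q \<in> cubes \<Longrightarrow> c \<le> N Q (indicat_real Q)"
    "\<And>Q. Q \<in> cubes \<Longrightarrow> N Q (indicat_real Q) \<le> C"
proof -
  have X: "quasi_banach_function_space Q (X Q) (N Q)" if "Q \<in> cubes" for Q
    using assms(1) that by (simp add: normalized_family_def)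
  obtain K where K: "\<And>Q. Q \<in> cubes \<Longrightarrow> quasi_triangle K (X Q) (N Q)"
    using assms(2) by (auto simp: uniform_quasi_triangle_def)
  obtain c C where c: "0 < c" and C: "0 < C"
    and bounds: "\<And>Q. Q \<in> cubes \<Longrightarrow> ennreal c \<le> ext_norm (X Q) (N Q) (indicat_real Q)"
      "\<And>Q. Q \<in> cubes \<Longrightarrow> ext_norm (X Q) (N Q) (indicat_real Q) \<le> ennreal C"
    using assms(1) unfolding normalized_family_def by blast
  \<comment> \<open>Membership of the indicator comes from the finite upper normalization
    bound.\<close>
  have ind: "indicat_real Q \<in> X Q \<and> N Q (indicat_real Q) \<le> C" if "Q \<in> cubes" for Q
    using bounds(2)[OF that] C by (simp add: ext_norm_le_iff)
  \<comment> \<open>The given \<open>K\<close> has no prescribed sign; \<open>max K 1\<close> is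
    positive, as the later estimates and constants require.\<close>
  have tri: "quasi_triangle (max K 1) (X Q) (N Q)" if "Q \<in> cubes" for Q
    by (rule quasi_triangle_mono[OF X[OF that] K[OF that]]) simp
  have ge: "c \<le> N Q (indicat_real Q)" if "Q \<in> cubes" for Q
    using bounds(1)[OF that] ind[OF that] c
    by (simp add: ext_norm_def ennreal_le_iff2)
  show thesis
    by (rule that[of "max K 1" c C])
      (use X tri c C ind ge in auto)
qed

theorem proposition3p9:
  fixes X :: "(real ^ 'n) set \<Rightarrow> (real ^ 'n \<Rightarrow> real) set"
    and N :: "(real ^ 'n) set \<Rightarrow> (real ^ 'n \<Rightarrow> real) \<Rightarrow> real"
  assumes "normalized_family X N"
    and "uniform_quasi_triangle X N"
  shows "(BMO_X X N \<subseteq> BMO \<and>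
          (\<exists>C>0. \<forall>f\<in>BMO_X X N. bmo_norm f \<le> ennreal C * bmo_X_norm X N f))
     \<longleftrightarrow> (\<exists>C>0. \<forall>f\<in>BMO_X X N.
            bmo_X_norm X N (\<lambda>x. \<bar>f x\<bar>) \<le> ennreal C * bmo_X_norm X N f)"
    (is "?emb \<longleftrightarrow> ?abs")
proof -
  obtain K c D where pos: "0 < K" "0 < c" "0 < D"
    and X: "\<And>Q. Q \<in> cubes \<Longrightarrow> quasi_banach_function_space Q (X Q) (N Q)"
    and tri: "\<And>Q. Q \<in> cubes \<Longrightarrow> quasi_triangle K (X Q) (N Q)"
    and ind: "\<And>Q. Q \<in> cubes \<Longrightarrow> indicat_real Q \<in> X Q"
    and lower: "\<And>Q. Q \<in> cubes \<Longrightarrow> c \<le> N Q (indicat_real Q)"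
    and upper: "\<And>Q. Q \<in> cubes \<Longrightarrow> N Q (indicat_real Q) \<le> D"
    using assms by (rule normalized_familyE) blast
  show ?thesis
  proof

    \<comment> \<open>From the embedding to the bound for absolute values\<close>
    assume ?emb
    then obtain C where C: "0 < C"
      "\<And>f. f \<in> BMO_X X N \<Longrightarrow> bmo_norm f \<le> ennreal C * bmo_X_norm X N f"
      by blast
    show ?abs
    \<comment> \<open>With \<open>B\<close> the norm of \<open>f\<close>, the oscillation of
      \<open>\<bar>f\<bar>\<close> is dominated by that of \<open>f\<close> plus the constant
      \<open>C * B\<close>; their quasi-norms are at most \<open>B\<close> and
      \<open>C * B * D\<close>.\<close>
    proof (intro exI[of _ "K * (1 + C * D)"] conjI ballI)
      show "0 < K * (1 + C * D)"
        using pos C by (simp add: add_pos_pos)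
      fix f assume "f \<in> BMO_X X N"
      then obtain B where f: "locally_integrable f" and B: "0 \<le> B" "bmo_X_norm X N f = ennreal B"
        by (rule BMO_X_D)
      have "bmo_norm f \<le> ennreal (C * B)"
        using C(2)[OF \<open>f \<in> BMO_X X N\<close>] B C by (simp add: ennreal_mult)
      then have m: "avg Q (\<lambda>x. \<bar>f x - avg Q f\<bar>) \<le> C * B" if "Q \<in> cubes" for Q
        using B C that by (simp add: bmo_norm_le_iff)
      have osc: "(\<lambda>x. f x - avg Q f) \<in> X Q" "N Q (\<lambda>x. f x - avg Q f) \<le> B" if "Q \<in> cubes" for Q
        using bmo_X_norm_le_iff[of B X N f] B that by auto
      have "(\<lambda>x. \<bar>f x\<bar> - avg Q (\<lambda>x. \<bar>f x\<bar>)) \<in> X Q \<and>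
          N Q (\<lambda>x. \<bar>f x\<bar> - avg Q (\<lambda>x. \<bar>f x\<bar>)) \<le> K * (1 + C * D) * B" (is "?h \<in> _ \<and> _")
        if Q: "Q \<in> cubes" for Q
      proof -
        have CB: "0 \<le> C * B"
          using B C by simp
        note const = quasi_norm_const_mult[OF X[OF Q] ind[OF Q] CB]
        have h: "?h \<in> borel_measurable (lebesgue_on Q)"
          by (intro locally_integrable_measurable_on_cube locally_integrable_diff_const
              locally_integrable_abs f Q)
        \<comment> \<open>Insert \<open>\<bar>avg Q f\<bar>\<close> between the two terms on the
          left: the first gap is at most \<open>\<bar>f x - avg Q f\<bar>\<close>, the second at
          most the mean oscillation, hence at most \<open>C * B\<close>.\<close>
        have "\<bar>\<bar>f x\<bar> - avg Q (\<lambda>x. \<bar>f x\<bar>)\<bar> \<le> \<bar>f x - avg Q f\<bar> + \<bar>C * B * indicat_real Q x\<bar>"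
          if "x \<in> Q" for x
          using abs_avg_abs_diff_le[OF f Q, of "avg Q f"] m[OF Q] CB that by simp
        note dom = quasi_norm_dominated[OF X[OF Q] tri[OF Q] osc(1)[OF Q] const(1) h this]
        have "N Q ?h \<le> K * (B + C * B * D)"
          using pos osc(2)[OF Q] upper[OF Q] CB const(2)
          by (intro order_trans[OF dom(2)]) (auto intro!: add_mono mult_left_mono)
        then show ?thesis
          using dom(1) by (simp add: algebra_simps)
      qed
      then have "bmo_X_norm X N (\<lambda>x. \<bar>f x\<bar>) \<le> ennreal (K * (1 + C * D) * B)"
        using pos C B by (subst bmo_X_norm_le_iff) auto
      then show "bmo_X_norm X N (\<lambda>x. \<bar>f x\<bar>) \<le> ennreal (K * (1 + C * D)) * bmo_X_norm X N f"
        using pos C B by (simp add: ennreal_mult)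
    qed
  next

    \<comment> \<open>From the bound for absolute values to the embedding\<close>
    assume ?abs
    then obtain C where C: "0 < C"
      "\<And>f. f \<in> BMO_X X N \<Longrightarrow> bmo_X_norm X N (\<lambda>x. \<bar>f x\<bar>) \<le> ennreal C * bmo_X_norm X N f"
      by blast
    \<comment> \<open>Obtained by solving \<open>m * c \<le> K * (C * B + B)\<close> for the mean
      oscillation \<open>m\<close>.\<close>
    define E where "E = K * (C + 1) / c"
    have E: "0 < E"
      using pos C by (simp add: E_def)
    have bound: "bmo_norm f \<le> ennreal E * bmo_X_norm X N f" if f_in: "f \<in> BMO_X X N" for f
    proof -
      obtain B where f: "locally_integrable f" and B: "0 \<le> B" "bmo_X_norm X N f = ennreal B"
        using f_in by (rule BMO_X_D)
      have "avg Q (\<lambda>x. \<bar>f x - avg Q f\<bar>) \<le> E * B" if Q: "Q \<in> cubes" for Q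
      proof -
        \<comment> \<open>The shift depends on the fixed cube \<open>Q\<close>, but the norm
          \<open>B\<close> of \<open>g\<close> does not.\<close>
        define g where "g = (\<lambda>x. f x - avg Q f)"
        define m where "m = avg Q (\<lambda>x. \<bar>g x\<bar>)"
        have m: "0 \<le> m"
          by (simp add: m_def avg_nonneg)
        have g_norm: "bmo_X_norm X N g = ennreal B"
          by (simp add: g_def bmo_X_norm_diff_const f B)
        then have "g \<in> BMO_X X N"
          by (simp add: BMO_X_def g_def locally_integrable_diff_const f)
        then have "bmo_X_norm X N (\<lambda>x. \<bar>g x\<bar>) \<le> ennreal (C * B)"
          using C(2)[of g] C B g_norm by (simp add: ennreal_mult)
        \<comment> \<open>The bound is read off on \<open>Q\<close> alone, where \<open>m\<close> is
          the average of \<open>\<bar>g\<bar>\<close>.\<close>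
        then have abs_g: "(\<lambda>x. \<bar>g x\<bar> - m) \<in> X Q" "N Q (\<lambda>x. \<bar>g x\<bar> - m) \<le> C * B"
          using bmo_X_norm_le_iff[of "C * B" X N "\<lambda>x. \<bar>g x\<bar>"] C B Q by (auto simp: m_def)
        have g: "g \<in> X Q" "N Q g \<le> B"
          using bmo_X_norm_le_iff[of B X N f] B Q by (auto simp: g_def)
        note const = quasi_norm_const_mult[OF X[OF Q] ind[OF Q] m]
        have meas: "(\<lambda>x. m * indicat_real Q x) \<in> borel_measurable (lebesgue_on Q)"
          using quasi_banach_function_space_measurable[OF X[OF Q]] const(1) by (rule subsetD)
        have "m * c \<le> m * N Q (indicat_real Q)"
          using lower[OF Q] m by (rule mult_left_mono)
        \<comment> \<open>On \<open>Q\<close>,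
          \<open>m = \<bar>g x\<bar> - (\<bar>g x\<bar> - m)\<close>, so the constant
          \<open>m\<close> is dominated by the sum of the two moduli.\<close>
        also have "\<dots> \<le> K * (N Q (\<lambda>x. \<bar>g x\<bar> - m) + N Q g)"
          unfolding const(2)[symmetric]
          by (rule quasi_norm_dominated(2)[OF X[OF Q] tri[OF Q] abs_g(1) g(1) meas])
            (use m in auto)
        also have "\<dots> \<le> K * (C * B + B)"
          using pos abs_g(2) g(2) by (intro mult_left_mono add_mono) auto
        finally have "m \<le> E * B"
          using pos by (simp add: E_def field_simps)
        then show ?thesis
          by (simp add: m_def g_def)
      qed
      then have "bmo_norm f \<le> ennreal (E * B)"
        using B E by (simp add: bmo_norm_le_iff)
      then show ?thesis
        using B E by (simp add: ennreal_mult)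
    qed
    \<comment> \<open>The right side of \<open>bound\<close> is finite on \<open>BMO_X X N\<close>,
      so the estimate already gives the inclusion.\<close>
    have "BMO_X X N \<subseteq> BMO"
    proof
      fix f assume f: "f \<in> BMO_X X N"
      then have "ennreal E * bmo_X_norm X N f < \<infinity>"
        by (simp add: BMO_X_def ennreal_mult_less_top)
      then show "f \<in> BMO"
        using f bound[OF f] by (auto simp: BMO_def BMO_X_def intro: le_less_trans)
    qed
    then show ?emb
      using E bound by blast
  qed
qed

end
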